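(* Let $N=\begin{pmatrix}p&r\\0&q\end{pmatrix}\in UT_2(\mathbb{Z})$. If $p\equiv 2\pmod 4$ or $q\equiv 2\pmod 4$, then there are no four matrices in $UT_2(\mathbb{Z})$ having the Jordan $D(N)$-property. Consequently, there is no upper-triangular Jordan $D(N)$-quadruple.
   Context: $UT_2(\mathbb{Z})$ denotes the ring of upper-triangular $2\times 2$ integer matrices, and $A\circ B=\frac12(AB+BA)$ (computed over $\mathbb{Q}$) is the Jordan product. For $N\in UT_2(\mathbb{Z})$, four matrices $A_1,A_2,A_3,A_4\in UT_2(\mathbb{Z})$ (not necessarily distinct or nonzero) have the Jordan $D(N)$-property if for every $1\le i<j\le 4$ there exists $X_{ij}\in UT_2(\mathbb{Z})$ with $A_i\circ A_j+N=X_{ij}^2$. If moreover the $A_i$ are distinct and nonzero, then $\{A_1,A_2,A_3,A_4\}$ is called an upper-triangular Jordan $D(N)$-quadruple. *)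

theory Defs
  imports "HOL-Analysis.Analysis" "HOL-Number_Theory.Cong"
begin

definition UT2_Z :: "(int^2^2) set" where
  "UT2_Z = {A. A $ 2 $ 1 = 0}"

definition rat_matrix :: "int^2^2 \<Rightarrow> rat^2^2" where
  "rat_matrix A = (\<chi> i j. of_int (A $ i $ j))"

text \<open>
  Multiplying by the scalar matrix \<open>mat (1/2)\<close> is the scaling by \<open>1/2\<close>.
\<close>

definition jordan_prod :: "rat^2^2 \<Rightarrow> rat^2^2 \<Rightarrow> rat^2^2" (infixl \<open>\<circ>\<^sub>J\<close> 70) where
  "A \<circ>\<^sub>J B = mat (1/2) ** (A ** B + B ** A)"

text \<open>
  Four matrices are the values of \<open>A\<close> at the indices \<open>1, 2, 3, 4\<close>; repetitions and zero
  matrices are allowed here. The Jordan product of integer matrices may have a half-integer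
  entry, so the equation is one between rational matrices, while the square root \<open>X\<close> is an
  integer matrix.
\<close>

definition jordan_D_property :: "int^2^2 \<Rightarrow> (nat \<Rightarrow> int^2^2) \<Rightarrow> bool" where
  "jordan_D_property N A \<longleftrightarrow>
     (\<forall>i\<in>{1..4}. A i \<in> UT2_Z) \<and>
     (\<forall>i j. 1 \<le> i \<and> i < j \<and> j \<le> 4 \<longrightarrow>
        (\<exists>X\<in>UT2_Z. (rat_matrix (A i) \<circ>\<^sub>J rat_matrix (A j)) + rat_matrix N = rat_matrix (X ** X)))"

definition jordan_D_quadruple :: "int^2^2 \<Rightarrow> (int^2^2) set \<Rightarrow> bool" where
  "jordan_D_quadruple N S \<longleftrightarrow>
     (\<exists>A. S = A ` {1..4} \<and> inj_on A {1..4} \<and> (\<forall>i\<in>{1..4}. A i \<noteq> 0) \<and> jordan_D_property N A)"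

end

theory Submission
  imports Defs
begin

text \<open>
  Diagonal entries of upper-triangular matrices multiply entrywise, and the Jordan product
  agrees with the ordinary product there. Hence the \<open>(k,k)\<close> entries \<open>a\<^sub>i\<close> of four matrices
  with the Jordan \<open>D(N)\<close>-property form a classical integer \<open>D(n)\<close>-family, \<open>n\<close> being the
  \<open>(k,k)\<close> entry of \<open>N\<close>: \<open>a\<^sub>i a\<^sub>j + n\<close> is a perfect square whenever \<open>i \<noteq> j\<close>.

  If \<open>n \<equiv> 2 (mod 4)\<close>, such a family of four integers does not exist. Squares are \<open>0\<close> or \<open>1\<close>
  modulo \<open>4\<close>, so \<open>a\<^sub>i a\<^sub>j\<close> must be \<open>2\<close> or \<open>3\<close> modulo \<open>4\<close>. But two even numbers have a product
  \<open>\<equiv> 0\<close>, and two odd numbers in the same residue class have a product \<open>\<equiv> 1\<close>. So no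
  two of the four integers share one of the three classes ``even'', \<open>1 (mod 4)\<close> and
  \<open>3 (mod 4)\<close>, contrary to the pigeonhole principle.
\<close>

lemma UT2_mult_diag:
  assumes "A \<in> UT2_Z" "B \<in> UT2_Z"
  shows "(A ** B) $ k $ k = A $ k $ k * B $ k $ k"
  using assms exhaust_2[of k]
  by (auto simp: UT2_Z_def matrix_matrix_mult_def sum_2)

lemma rat_matrix_mult: "rat_matrix (A ** B) = rat_matrix A ** rat_matrix B"
  by (simp add: rat_matrix_def matrix_matrix_mult_def vec_eq_iff)

lemma jordan_prod_nth: "(A \<circ>\<^sub>J B) $ i $ j = ((A ** B) $ i $ j + (B ** A) $ i $ j) / 2"
  using exhaust_2[of i]
  by (auto simp: jordan_prod_def mat_def matrix_matrix_mult_def sum_2)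

text \<open>Off the diagonal this fails: there the Jordan product can have a half-integer entry.\<close>

lemma jordan_prod_diag:
  assumes "A \<in> UT2_Z" "B \<in> UT2_Z"
  shows "(rat_matrix A \<circ>\<^sub>J rat_matrix B) $ k $ k = of_int (A $ k $ k * B $ k $ k)"
proof -
  have "(rat_matrix A \<circ>\<^sub>J rat_matrix B) $ k $ k
      = (of_int ((A ** B) $ k $ k) + of_int ((B ** A) $ k $ k)) / 2"
    unfolding jordan_prod_nth rat_matrix_mult[symmetric] by (simp add: rat_matrix_def)
  then show ?thesis
    using assms by (simp add: UT2_mult_diag mult.commute)
qed

lemma jordan_D_property_diag:
  assumes "jordan_D_property N A" "1 \<le> i" "i < j" "j \<le> 4"
  shows "\<exists>x. A i $ k $ k * A j $ k $ k + N $ k $ k = x\<^sup>2"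
proof -
  from assms obtain X where X: "X \<in> UT2_Z"
    and eq: "(rat_matrix (A i) \<circ>\<^sub>J rat_matrix (A j)) + rat_matrix N = rat_matrix (X ** X)"
    unfolding jordan_D_property_def by blast
  have "A i \<in> UT2_Z" "A j \<in> UT2_Z"
    using assms by (auto simp: jordan_D_property_def)
  then have "(of_int (A i $ k $ k * A j $ k $ k + N $ k $ k) :: rat) = of_int ((X ** X) $ k $ k)"
    using arg_cong[OF eq, of "\<lambda>M. M $ k $ k"]
    by (simp add: jordan_prod_diag) (simp add: rat_matrix_def)
  then show ?thesis
    unfolding of_int_eq_iff using X by (auto simp: UT2_mult_diag power2_eq_square)
qed

text \<open>The three classes for the pigeonhole argument are \<open>{0, 2}\<close>, \<open>{1}\<close> and \<open>{3}\<close> modulo \<open>4\<close>.\<close>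

lemma D_pair_separated_mod_4:
  fixes a b n x :: int
  assumes "[n = 2] (mod 4)" "a * b + n = x\<^sup>2"
  shows "odd a \<or> odd b" "a mod 4 \<noteq> b mod 4"
proof -
  have res: "c mod 4 = 0 \<or> c mod 4 = 1 \<or> c mod 4 = 2 \<or> c mod 4 = 3" for c :: int
    by presburger
  have "x\<^sup>2 mod 4 = ((x mod 4) * (x mod 4)) mod 4"
    by (simp add: power2_eq_square mod_mult_eq)
  then have "x\<^sup>2 mod 4 = 0 \<or> x\<^sup>2 mod 4 = 1"
    using res[of x] by auto
  moreover have "n mod 4 = 2"
    using assms(1) by (simp add: cong_def)
  ultimately have "(a * b) mod 4 = 2 \<or> (a * b) mod 4 = 3"
    using assms(2) by presburger
  then have prod: "((a mod 4) * (b mod 4)) mod 4 = 2 \<or> ((a mod 4) * (b mod 4)) mod 4 = 3"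
    by (simp add: mod_mult_eq)
  then show "a mod 4 \<noteq> b mod 4"
    using res[of a] by auto
  show "odd a \<or> odd b"
  proof (rule ccontr)
    assume "\<not> (odd a \<or> odd b)"
    then have "a mod 4 = 0 \<or> a mod 4 = 2" "b mod 4 = 0 \<or> b mod 4 = 2"
      by presburger+
    then show False
      using prod by auto
  qed
qed

lemma no_integer_D_family_of_four:
  fixes a :: "nat \<Rightarrow> int" and n :: int
  assumes n: "[n = 2] (mod 4)"
    and sq: "\<And>i j. 1 \<le> i \<Longrightarrow> i < j \<Longrightarrow> j \<le> 4 \<Longrightarrow> \<exists>x. a i * a j + n = x\<^sup>2"
  shows False
proof -
  define cls where "cls c = (if even c then 0 else c mod 4)" for c :: int
  have differ: "cls (a i) \<noteq> cls (a j)" if ij: "1 \<le> i" "i < j" "j \<le> 4" for i j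
  proof -
    obtain x where "a i * a j + n = x\<^sup>2"
      using sq[OF ij] by blast
    from D_pair_separated_mod_4[OF n this] show ?thesis
      unfolding cls_def by presburger
  qed
  have "inj_on (\<lambda>i. cls (a i)) {1..4}"
    by (rule linorder_inj_onI) (use differ in auto)
  moreover have "(\<lambda>i. cls (a i)) ` {1..4} \<subseteq> {0, 1, 3}"
  proof -
    have "cls c \<in> {0, 1, 3}" for c
      unfolding cls_def by simp presburger
    then show ?thesis by blast
  qed
  ultimately have "card {1..4::nat} \<le> card {0, 1, 3 :: int}"
    by (intro card_inj_on_le) auto
  then show False by simp
qed

theorem proposition8:
  fixes p q r :: int and N :: "int^2^2"
  assumes "N = vector [vector [p, r], vector [0, q]]"
    and "[p = 2] (mod 4) \<or> [q = 2] (mod 4)"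
  shows "(\<nexists>A. jordan_D_property N A) \<and> (\<nexists>S. jordan_D_quadruple N S)"
proof -
  have "N $ 1 $ 1 = p" "N $ 2 $ 2 = q"
    using assms(1) by (simp_all add: vector_2)
  then obtain k where k: "[N $ k $ k = 2] (mod 4)"
    using assms(2) by metis
  have "\<not> jordan_D_property N A" for A
    using no_integer_D_family_of_four[OF k, of "\<lambda>i. A i $ k $ k"] jordan_D_property_diag
    by blast
  then show ?thesis
    by (auto simp: jordan_D_quadruple_def)
qed

end
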